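(* Let $\mathfrak g$ be a real Lie algebra endowed with a complex structure $J$, and let $\omega_{pK}$ and $\omega_{cs}$ be symplectic forms on $\mathfrak g$ with respect to which $J$ is, respectively, skew-symmetric and symmetric. Define $E:\mathfrak g\to\mathfrak g$ by $E=\omega_{pK}^{-1}\circ\omega_{cs}$ and let $g=-\omega_{pK}\circ J$ be the pseudo-Kähler metric, i.e. $g(X,Y)=\omega_{pK}(X,JY)$ for $X,Y\in\mathfrak g$. Then $(J,E,g)$ is a hypersymplectic structure on $\mathfrak g$ if and only if $E$ is an almost product structure.
   Context: Lie algebras are real and finite-dimensional. For an endomorphism $A$ of a Lie algebra $\mathfrak g$ put $N_A(X,Y)=-A^2[X,Y]+A[AX,Y]+A[X,AY]-[AX,AY]$; $A$ is integrable if $N_A\equiv0$. A complex structure is an integrable $J$ with $J^2=-\mathrm{Id}$. An almost product structure is an endomorphism $E$ with $E^2=\mathrm{Id}$ and $E\neq\pm\mathrm{Id}$; a product structure is an integrable almost product structure. A complex product structure is a pair $(J,E)$ of a complex structure and a product structure with $J\circ E=-E\circ J$. A scalar product (nondegenerate symmetric bilinear form) $g$ is compatible with $(J,E)$ if $g(JX,JY)=g(X,Y)$ and $g(EX,EY)=-g(X,Y)$ for all $X,Y$. A hypersymplectic structure is a triple $(J,E,g)$ with $(J,E)$ a complex product structure and $g$ a compatible metric such that $\omega_1(X,Y)=g(JX,Y)$ or $\omega_3(X,Y)=g((J\circ E)X,Y)$ is closed (closedness of one of the two is equivalent to closedness of the other). A symplectic form on a $2m$-dimensional Lie algebra is a closed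 $\omega\in\Lambda^2\mathfrak g^*$ with $\omega^m\ne0$, with $d$ the Chevalley–Eilenberg differential ($d\alpha(X,Y)=-\alpha([X,Y])$ on $\mathfrak g^*$). $J$ is symmetric with respect to $\omega$ if $\omega(JX,Y)=\omega(X,JY)$ for all $X,Y$, and skew-symmetric if $\omega(JX,Y)=-\omega(X,JY)$ for all $X,Y$. A bilinear form $b$ is also regarded as the map $b:\mathfrak g\to\mathfrak g^*$, $b(X)(Y)=b(X,Y)$; thus $E=\omega_{pK}^{-1}\circ\omega_{cs}$ means $\omega_{pK}(EX,Y)=\omega_{cs}(X,Y)$ for all $X,Y$. *)

theory Defs
  imports "HOL-Analysis.Analysis" "HOL-Combinatorics.Permutations"
begin

section \<open>Real finite-dimensional Lie algebras\<close>

text \<open>The underlying vector space is a whole type of class \<open>real_vector\<close>, and the bracket is an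
  explicit operation on it.\<close>

definition lie_algebra :: "('a::real_vector \<Rightarrow> 'a \<Rightarrow> 'a) \<Rightarrow> bool" where
  "lie_algebra br \<longleftrightarrow>
     (\<exists>B::'a set. finite B \<and> span B = UNIV) \<and>
     bilinear br \<and>
     (\<forall>X. br X X = 0) \<and>
     (\<forall>X Y Z. br X (br Y Z) + br Y (br Z X) + br Z (br X Y) = 0)"

section \<open>Complex, product and complex product structures\<close>

definition nijenhuis :: "('a::real_vector \<Rightarrow> 'a \<Rightarrow> 'a) \<Rightarrow> ('a \<Rightarrow> 'a) \<Rightarrow> 'a \<Rightarrow> 'a \<Rightarrow> 'a" where
  "nijenhuis br A X Y = - A (A (br X Y)) + A (br (A X) Y) + A (br X (A Y)) - br (A X) (A Y)"

definition integrable_endo :: "('a::real_vector \<Rightarrow> 'a \<Rightarrow> 'a) \<Rightarrow> ('a \<Rightarrow> 'a) \<Rightarrow> bool" where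
  "integrable_endo br A \<longleftrightarrow> linear A \<and> (\<forall>X Y. nijenhuis br A X Y = 0)"

definition complex_structure :: "('a::real_vector \<Rightarrow> 'a \<Rightarrow> 'a) \<Rightarrow> ('a \<Rightarrow> 'a) \<Rightarrow> bool" where
  "complex_structure br J \<longleftrightarrow> integrable_endo br J \<and> J \<circ> J = (\<lambda>X. - X)"

definition almost_product_structure :: "('a::real_vector \<Rightarrow> 'a) \<Rightarrow> bool" where
  "almost_product_structure E \<longleftrightarrow> linear E \<and> E \<circ> E = id \<and> E \<noteq> id \<and> E \<noteq> (\<lambda>X. - X)"

definition product_structure :: "('a::real_vector \<Rightarrow> 'a \<Rightarrow> 'a) \<Rightarrow> ('a \<Rightarrow> 'a) \<Rightarrow> bool" where
  "product_structure br E \<longleftrightarrow> almost_product_structure E \<and> integrable_endo br E"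

definition complex_product_structure ::
    "('a::real_vector \<Rightarrow> 'a \<Rightarrow> 'a) \<Rightarrow> ('a \<Rightarrow> 'a) \<Rightarrow> ('a \<Rightarrow> 'a) \<Rightarrow> bool" where
  "complex_product_structure br J E \<longleftrightarrow>
     complex_structure br J \<and> product_structure br E \<and> J \<circ> E = (\<lambda>X. - E (J X))"

section \<open>Exterior forms\<close>

text \<open>A form of degree \<open>k\<close> is represented by a functional on sequences of vectors that looks only
  at the entries with index below \<open>k\<close>; the degree is passed explicitly to the operations.\<close>

type_synonym 'a form = "(nat \<Rightarrow> 'a) \<Rightarrow> real"

definition two_form :: "('a \<Rightarrow> 'a \<Rightarrow> real) \<Rightarrow> 'a form" where
  "two_form \<omega> v = \<omega> (v 0) (v 1)"

definition wedge :: "nat \<Rightarrow> nat \<Rightarrow> 'a form \<Rightarrow> 'a form \<Rightarrow> 'a form" where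
  "wedge p q \<alpha> \<beta> v =
     (\<Sum>\<sigma> | \<sigma> permutes {..<p + q}.
        of_int (sign \<sigma>) * \<alpha> (\<lambda>i. v (\<sigma> i)) * \<beta> (\<lambda>i. v (\<sigma> (p + i)))) / (fact p * fact q)"

text \<open>\<open>wedge_power \<omega> m\<close> is the form of degree \<open>2 * m\<close> given by the \<open>m\<close>-th exterior power
  of \<open>\<omega>\<close>.\<close>

primrec wedge_power :: "('a \<Rightarrow> 'a \<Rightarrow> real) \<Rightarrow> nat \<Rightarrow> 'a form" where
  "wedge_power \<omega> 0 = (\<lambda>v. 1)"
| "wedge_power \<omega> (Suc m) = wedge 2 (2 * m) (two_form \<omega>) (wedge_power \<omega> m)"

text \<open>The Chevalley--Eilenberg differential of a \<open>k\<close>-form with trivial coefficients,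
  \[ d\alpha(v_0,\dots,v_k) = \sum_{i<j} (-1)^{i+j}
       \alpha([v_i,v_j],v_0,\dots,\hat v_i,\dots,\hat v_j,\dots,v_k). \]
  The entry after the bracket with index \<open>l\<close> is the \<open>l\<close>-th of the vectors that remain once
  \<open>v i\<close> and \<open>v j\<close> are omitted.\<close>

definition ce_diff :: "('a \<Rightarrow> 'a \<Rightarrow> 'a) \<Rightarrow> nat \<Rightarrow> 'a form \<Rightarrow> 'a form" where
  "ce_diff br k \<alpha> v =
     (\<Sum>j\<le>k. \<Sum>i<j. (- 1) ^ (i + j) *
        \<alpha> (\<lambda>n. case n of
                  0 \<Rightarrow> br (v i) (v j)
                | Suc l \<Rightarrow> v (if l < i then l else if l + 1 < j then l + 1 else l + 2)))"

definition closed_form :: "('a \<Rightarrow> 'a \<Rightarrow> 'a) \<Rightarrow> ('a \<Rightarrow> 'a \<Rightarrow> real) \<Rightarrow> bool" where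
  "closed_form br \<omega> \<longleftrightarrow> (\<forall>v. ce_diff br 2 (two_form \<omega>) v = 0)"

lemma ce_diff_one_form: "ce_diff br 1 (\<lambda>v. \<alpha> (v 0)) v = - \<alpha> (br (v 0) (v 1))"
  by (simp add: ce_diff_def)

lemma ce_diff_two_form:
  "ce_diff br 2 (two_form \<omega>) v =
     - \<omega> (br (v 0) (v 1)) (v 2) + \<omega> (br (v 0) (v 2)) (v 1) - \<omega> (br (v 1) (v 2)) (v 0)"
  by (simp add: ce_diff_def two_form_def numeral_2_eq_2)

lemma wedge_one_forms:
  "wedge 1 1 (\<lambda>v. \<alpha> (v 0)) (\<lambda>v. \<beta> (v 0)) v = \<alpha> (v 0) * \<beta> (v 1) - \<alpha> (v 1) * \<beta> (v 0)"
proof -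
  have "{..<1 + 1} = {0, 1::nat}" by auto
  then have "{\<sigma>. \<sigma> permutes {..<1 + 1}} = {id, Transposition.transpose 0 (1::nat)}"
    using permutes_doubleton_iff[of _ 0 "1::nat"] by auto
  moreover have "id \<noteq> Transposition.transpose 0 (1::nat)"
    by (metis id_apply transpose_apply_first zero_neq_one)
  ultimately show ?thesis
    by (simp add: wedge_def sign_swap_id)
qed

section \<open>Symplectic and hypersymplectic structures\<close>

definition symplectic_form ::
    "('a::real_vector \<Rightarrow> 'a \<Rightarrow> 'a) \<Rightarrow> ('a \<Rightarrow> 'a \<Rightarrow> real) \<Rightarrow> bool" where
  "symplectic_form br \<omega> \<longleftrightarrow>
     bilinear \<omega> \<and> (\<forall>X. \<omega> X X = 0) \<and> closed_form br \<omega> \<and>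
     (\<exists>m. dim (UNIV :: 'a set) = 2 * m \<and> (\<exists>v. wedge_power \<omega> m v \<noteq> 0))"

definition symmetric_wrt :: "('a \<Rightarrow> 'a) \<Rightarrow> ('a \<Rightarrow> 'a \<Rightarrow> real) \<Rightarrow> bool" where
  "symmetric_wrt J \<omega> \<longleftrightarrow> (\<forall>X Y. \<omega> (J X) Y = \<omega> X (J Y))"

definition skew_symmetric_wrt :: "('a \<Rightarrow> 'a) \<Rightarrow> ('a \<Rightarrow> 'a \<Rightarrow> real) \<Rightarrow> bool" where
  "skew_symmetric_wrt J \<omega> \<longleftrightarrow> (\<forall>X Y. \<omega> (J X) Y = - \<omega> X (J Y))"

definition scalar_product :: "('a::real_vector \<Rightarrow> 'a \<Rightarrow> real) \<Rightarrow> bool" where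
  "scalar_product g \<longleftrightarrow>
     bilinear g \<and> (\<forall>X Y. g X Y = g Y X) \<and> (\<forall>X. (\<forall>Y. g X Y = 0) \<longrightarrow> X = 0)"

definition compatible_metric ::
    "('a::real_vector \<Rightarrow> 'a) \<Rightarrow> ('a \<Rightarrow> 'a) \<Rightarrow> ('a \<Rightarrow> 'a \<Rightarrow> real) \<Rightarrow> bool" where
  "compatible_metric J E g \<longleftrightarrow>
     scalar_product g \<and> (\<forall>X Y. g (J X) (J Y) = g X Y) \<and> (\<forall>X Y. g (E X) (E Y) = - g X Y)"

definition hypersymplectic_structure ::
    "('a::real_vector \<Rightarrow> 'a \<Rightarrow> 'a) \<Rightarrow> ('a \<Rightarrow> 'a) \<Rightarrow> ('a \<Rightarrow> 'a) \<Rightarrow> ('a \<Rightarrow> 'a \<Rightarrow> real) \<Rightarrow> bool" where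
  "hypersymplectic_structure br J E g \<longleftrightarrow>
     complex_product_structure br J E \<and> compatible_metric J E g \<and>
     (closed_form br (\<lambda>X Y. g (J X) Y) \<or> closed_form br (\<lambda>X Y. g ((J \<circ> E) X) Y))"

text \<open>A curried form \<open>b :: 'a \<Rightarrow> 'a \<Rightarrow> real\<close> is itself the map from the Lie algebra into its
  dual that sends \<open>X\<close> to \<open>b X\<close>. Since the values of this map are linear functionals, \<open>inv b\<close>
  is meaningful on linear functionals only, where it is the inverse of \<open>b\<close> if \<open>b\<close> is
  nondegenerate.\<close>

definition recursion_operator ::
    "('a \<Rightarrow> 'a \<Rightarrow> real) \<Rightarrow> ('a \<Rightarrow> 'a \<Rightarrow> real) \<Rightarrow> 'a \<Rightarrow> 'a" where
  "recursion_operator \<omega>\<^sub>1 \<omega>\<^sub>2 = inv \<omega>\<^sub>1 \<circ> \<omega>\<^sub>2"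

definition pseudo_kaehler_metric :: "('a \<Rightarrow> 'a) \<Rightarrow> ('a \<Rightarrow> 'a \<Rightarrow> real) \<Rightarrow> 'a \<Rightarrow> 'a \<Rightarrow> real" where
  "pseudo_kaehler_metric J \<omega> X Y = \<omega> X (J Y)"

end

theory Submission
  imports Defs
begin

text \<open>Since \<open>\<omega>pK\<close> is nondegenerate, \<open>E\<close> is characterised by \<open>\<omega>pK (E X) Y = \<omega>cs X Y\<close>.
  Hence \<open>E\<close> is self-adjoint for \<open>\<omega>pK\<close>, and the two symmetry conditions on \<open>J\<close> make \<open>J\<close> and \<open>E\<close>
  anticommute. If \<open>E \<circ> E = id\<close>, the three forms \<open>\<omega>pK X Y\<close>, \<open>\<omega>pK (E X) Y\<close> and
  \<open>\<omega>pK (E (E X)) Y\<close> are closed, and the Nijenhuis tensor of \<open>E\<close> paired with \<open>\<omega>pK\<close> is a combination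
  of their differentials. Finally \<open>g (J X) Y = \<omega>pK X Y\<close> is closed.\<close>

section \<open>Nondegeneracy of symplectic forms\<close>

text \<open>The sign comes from the antisymmetrization in \<open>wedge\<close> alone: left
  composition with a transposition permutes the index set of the sum and flips
  \<open>sign\<close>.\<close>

lemma wedge_transpose:
  assumes "i < p + q" "j < p + q" "i \<noteq> j"
  shows "wedge p q \<alpha> \<beta> (v \<circ> Transposition.transpose i j) = - wedge p q \<alpha> \<beta> v"
proof -
  let ?t = "Transposition.transpose i j" and ?P = "{\<sigma>. \<sigma> permutes {..<p + q}}"
  define f where "f \<sigma> = of_int (sign \<sigma>) * \<alpha> (\<lambda>i. v (\<sigma> i)) * \<beta> (\<lambda>i. v (\<sigma> (p + i)))" for \<sigma>
  define h where "h \<sigma> = of_int (sign \<sigma>) * \<alpha> (\<lambda>i. v (?t (\<sigma> i))) * \<beta> (\<lambda>i. v (?t (\<sigma> (p + i))))" for \<sigma>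
  have t: "?t permutes {..<p + q}" using assms by (intro permutes_swap_id) auto
  have bij: "bij_betw (\<lambda>\<sigma>. ?t \<circ> \<sigma>) ?P ?P"
  proof (rule bij_betwI[where g = "\<lambda>\<sigma>. ?t \<circ> \<sigma>"])
    show "(\<lambda>\<sigma>. ?t \<circ> \<sigma>) \<in> ?P \<rightarrow> ?P" using t by (auto intro: permutes_compose)
    then show "(\<lambda>\<sigma>. ?t \<circ> \<sigma>) \<in> ?P \<rightarrow> ?P" .
  qed (simp_all add: o_assoc)
  have h: "h \<sigma> = - f (?t \<circ> \<sigma>)" if "\<sigma> \<in> ?P" for \<sigma>
  proof -
    have "permutation \<sigma>" using that by (auto intro: permutation_permutes[THEN iffD2])
    then have "sign (?t \<circ> \<sigma>) = - sign \<sigma>"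
      using assms by (simp add: sign_compose permutation_swap_id sign_swap_id)
    then show ?thesis by (simp add: f_def h_def)
  qed
  have "sum h ?P = - (\<Sum>\<sigma>\<in>?P. f (?t \<circ> \<sigma>))"
    using h by (simp add: sum_negf)
  also have "(\<Sum>\<sigma>\<in>?P. f (?t \<circ> \<sigma>)) = sum f ?P"
    using sum.reindex_bij_betw[OF bij] .
  finally show ?thesis by (simp add: wedge_def f_def h_def)
qed

lemma wedge_eq_entries:
  assumes "i < p + q" "j < p + q" "i \<noteq> j" "v i = v j"
  shows "wedge p q \<alpha> \<beta> v = 0"
proof -
  have "v \<circ> Transposition.transpose i j = v"
    using assms(4) by (auto simp: fun_eq_iff Transposition.transpose_def)
  then show ?thesis using wedge_transpose[OF assms(1-3), of \<alpha> \<beta> v] by simp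
qed

text \<open>A functional of type \<open>'a form\<close> receives an infinite sequence, so having
  degree at most \<open>n\<close> is a property to be carried along.\<close>

definition depends_below :: "nat \<Rightarrow> 'a form \<Rightarrow> bool" where
  "depends_below n \<alpha> \<longleftrightarrow> (\<forall>v w. (\<forall>i<n. v i = w i) \<longrightarrow> \<alpha> v = \<alpha> w)"

definition linear_slots :: "nat \<Rightarrow> ('a::real_vector) form \<Rightarrow> bool" where
  "linear_slots n \<alpha> \<longleftrightarrow> (\<forall>v. \<forall>k<n. linear (\<lambda>x. \<alpha> (v(k := x))))"

lemma depends_below_wedge:
  assumes "depends_below p \<alpha>" "depends_below q \<beta>"
  shows "depends_below (p + q) (wedge p q \<alpha> \<beta>)"
  unfolding depends_below_def
proof (intro allI impI)
  fix v w :: "nat \<Rightarrow> 'a"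
  assume vw: "\<forall>i<p + q. v i = w i"
  have "\<alpha> (\<lambda>i. v (\<sigma> i)) = \<alpha> (\<lambda>i. w (\<sigma> i)) \<and> \<beta> (\<lambda>i. v (\<sigma> (p + i))) = \<beta> (\<lambda>i. w (\<sigma> (p + i)))"
    if "\<sigma> permutes {..<p + q}" for \<sigma>
  proof -
    have "\<sigma> i < p + q" if "i < p + q" for i
      using permutes_in_image[OF \<open>\<sigma> permutes _\<close>, of i] that by simp
    then show ?thesis using assms vw unfolding depends_below_def by simp
  qed
  then show "wedge p q \<alpha> \<beta> v = wedge p q \<alpha> \<beta> w" by (simp add: wedge_def)
qed

lemma linear_real_mult:
  fixes f :: "'a::real_vector \<Rightarrow> real"
  assumes "linear f"
  shows "linear (\<lambda>x. a * f x * b)"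
  using assms by (simp add: linear_iff algebra_simps)

text \<open>In each summand a given entry of \<open>v\<close> reaches only one of the two factors,
  so the product is linear in it.\<close>

lemma linear_slots_wedge:
  assumes "depends_below p \<alpha>" "depends_below q \<beta>" "linear_slots p \<alpha>" "linear_slots q \<beta>"
  shows "linear_slots (p + q) (wedge p q \<alpha> \<beta>)"
  unfolding linear_slots_def
proof (intro allI impI)
  fix v :: "nat \<Rightarrow> 'a" and k assume k: "k < p + q"
  have "linear (\<lambda>x. of_int (sign \<sigma>) * \<alpha> (\<lambda>i. (v(k := x)) (\<sigma> i)) *
      \<beta> (\<lambda>i. (v(k := x)) (\<sigma> (p + i))) / (fact p * fact q))" (is "linear ?f")
    if \<sigma>: "\<sigma> permutes {..<p + q}" for \<sigma>
  proof -
    \<comment> \<open>The position \<open>l\<close> holds the varying vector; whether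
      \<open>l < p\<close> decides which factor varies.\<close>
    obtain l where l: "\<sigma> l = k" "l < p + q"
      using k \<sigma> by (metis lessThan_iff permutes_def permutes_in_image)
    have eq: "\<sigma> i = k \<longleftrightarrow> i = l" for i
      using l(1) permutes_inj[OF \<sigma>] by (auto dest: injD)
    show ?thesis
    proof (cases "l < p")
      case True
      have "\<beta> (\<lambda>i. (v(k := x)) (\<sigma> (p + i))) = \<beta> (\<lambda>i. v (\<sigma> (p + i)))" for x
        using True by (intro arg_cong[where f = \<beta>]) (auto simp: eq)
      moreover have "(\<lambda>i. (v(k := x)) (\<sigma> i)) = (\<lambda>i. v (\<sigma> i))(l := x)" for x
        by (auto simp: eq)
      moreover have "linear (\<lambda>x. \<alpha> ((\<lambda>i. v (\<sigma> i))(l := x)))"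
        using assms(3) True unfolding linear_slots_def by blast
      ultimately show ?thesis
        using linear_real_mult[of _ "of_int (sign \<sigma>)" "\<beta> (\<lambda>i. v (\<sigma> (p + i))) / (fact p * fact q)"]
        by (simp only: times_divide_eq_right mult.assoc)
    next
      case False
      then obtain r where r: "l = p + r" "r < q"
        using l(2) by (metis add_less_cancel_left le_Suc_ex not_less)
      \<comment> \<open>Unlike \<open>\<beta>\<close> in the other case, \<open>\<alpha>\<close> is
        handed a sequence that does change, at the index \<open>l\<close>; it is constant in
        \<open>x\<close> because it ignores indices from \<open>p\<close> on.\<close>
      have "\<alpha> (\<lambda>i. (v(k := x)) (\<sigma> i)) = \<alpha> (\<lambda>i. v (\<sigma> i))" for x
        using assms(1) False unfolding depends_below_def by (auto simp: eq)
      moreover have "(\<lambda>i. (v(k := x)) (\<sigma> (p + i))) = (\<lambda>i. v (\<sigma> (p + i)))(r := x)" for x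
        using r by (auto simp: eq)
      moreover have "linear (\<lambda>x. \<beta> ((\<lambda>i. v (\<sigma> (p + i)))(r := x)))"
        using assms(4) r unfolding linear_slots_def by blast
      ultimately show ?thesis
        using linear_real_mult[of _ "of_int (sign \<sigma>) * \<alpha> (\<lambda>i. v (\<sigma> i))" "1 / (fact p * fact q)"]
        by (simp only: times_divide_eq_right mult_1_right)
    qed
  qed
  then show "linear (\<lambda>x. wedge p q \<alpha> \<beta> (v(k := x)))"
    unfolding wedge_def sum_divide_distrib by (intro linear_compose_sum) auto
qed

lemma depends_below_two_form: "depends_below 2 (two_form \<omega>)"
  by (simp add: depends_below_def two_form_def)

lemma linear_slots_two_form:
  assumes "bilinear \<omega>"
  shows "linear_slots 2 (two_form \<omega>)"
  using assms by (auto simp: linear_slots_def two_form_def bilinear_def less_2_cases_iff)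

lemma wedge_power_slots:
  assumes "bilinear \<omega>"
  shows "depends_below (2 * m) (wedge_power \<omega> m) \<and> linear_slots (2 * m) (wedge_power \<omega> m)"
proof (induction m)
  case 0
  show ?case by (simp add: depends_below_def linear_slots_def)
next
  case (Suc m)
  have "2 * Suc m = 2 + 2 * m" by simp
  moreover have "depends_below (2 + 2 * m) (wedge_power \<omega> (Suc m))"
    using Suc by (simp only: wedge_power.simps(2) depends_below_wedge depends_below_two_form)
  moreover have "linear_slots (2 + 2 * m) (wedge_power \<omega> (Suc m))"
    using Suc by (simp only: wedge_power.simps(2) linear_slots_wedge depends_below_two_form
        linear_slots_two_form[OF assms])
  ultimately show ?case by (simp only:)
qed

lemma wedge_power_eq_entries:
  assumes "i < 2 * m" "j < 2 * m" "i \<noteq> j" "v i = v j"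
  shows "wedge_power \<omega> m v = 0"
proof (cases m)
  case (Suc n)
  then show ?thesis using assms wedge_eq_entries[of i 2 "2 * n" j v] by simp
qed (use assms in simp)

text \<open>The power sees its vectors only through their pairwise pairings, so they may be shifted
  along the kernel of \<open>\<omega>\<close>.\<close>

lemma wedge_power_cong:
  assumes "\<And>i j. \<omega> (v i) (v j) = \<omega> (w i) (w j)"
  shows "wedge_power \<omega> m v = wedge_power \<omega> m w"
  using assms
proof (induction m arbitrary: v w)
  case (Suc m)
  have "wedge_power \<omega> m (\<lambda>i. v (\<sigma> (2 + i))) = wedge_power \<omega> m (\<lambda>i. w (\<sigma> (2 + i)))" for \<sigma>
    by (rule Suc.IH) (rule Suc.prems)
  then show ?case using Suc.prems by (simp add: wedge_def two_form_def)
qed simp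

text \<open>As a function of the entry \<open>k\<close> the power is linear, and it vanishes at
  every other \<open>w i\<close>, where an entry is repeated.\<close>

lemma wedge_power_dependent:
  assumes "bilinear \<omega>" and "k < 2 * m" and "w k \<in> span (w ` ({..<2 * m} - {k}))"
  shows "wedge_power \<omega> m w = 0"
proof -
  let ?f = "\<lambda>x. wedge_power \<omega> m (w(k := x))"
  have "linear ?f" using wedge_power_slots[OF assms(1)] assms(2) unfolding linear_slots_def by blast
  moreover have "?f x = 0" if x: "x \<in> w ` ({..<2 * m} - {k})" for x
  proof -
    obtain i where "i < 2 * m" "i \<noteq> k" "x = w i" using x by auto
    then show ?thesis using assms(2) wedge_power_eq_entries[of i m k "w(k := x)"] by simp
  qed
  ultimately have "?f (w k) = 0" using assms(3) by (rule linear_eq_0_on_span)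
  then show ?thesis by simp
qed

text \<open>A basis extending \<open>S\<close> is finite because \<open>B\<close> spans, and it has
  no more elements than \<open>S\<close>.\<close>

lemma independent_card_eq_dim_span:
  fixes S B :: "'a::real_vector set"
  assumes "finite B" "span B = UNIV" "independent S" "card S = dim (UNIV :: 'a set)"
  shows "span S = UNIV"
proof -
  let ?T = "extend_basis S"
  have T: "S \<subseteq> ?T" "independent ?T" "span ?T = UNIV"
    using assms(3) extend_basis_superset independent_extend_basis span_extend_basis by auto
  have "finite ?T" using independent_span_bound[OF assms(1) T(2)] assms(2) by simp
  moreover have "card ?T = dim (UNIV :: 'a set)"
    using dim_eq_card[of ?T UNIV] T by simp
  ultimately have "S = ?T" using T(1) assms(4) by (metis card_subset_eq)
  then show ?thesis using T(3) by simp
qed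

lemma bilinear_alternating_swap:
  assumes "bilinear b" "\<And>X. b X X = 0"
  shows "b X Y = - b Y X"
proof -
  have "b (X + Y) (X + Y) = b X X + b X Y + b Y X + b Y Y"
    by (simp add: bilinear_ladd[OF assms(1)] bilinear_radd[OF assms(1)])
  then show ?thesis by (simp add: assms(2) eq_neg_iff_add_eq_0)
qed

text \<open>Along a vector \<open>X\<close> in the kernel of \<open>\<omega>\<close>, the entries of \<open>wedge_power \<omega> m\<close> may be projected to a
  hyperplane, where \<open>2 * m\<close> vectors are dependent.\<close>

lemma symplectic_nondegenerate:
  fixes \<omega> :: "'a::real_vector \<Rightarrow> 'a \<Rightarrow> real"
  assumes "finite B" "span B = (UNIV :: 'a set)" and "symplectic_form br \<omega>" and ker: "\<And>Y. \<omega> X Y = 0"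
  shows "X = 0"
proof (rule ccontr)
  assume "X \<noteq> 0"
  obtain m v where bil: "bilinear \<omega>" and alt: "\<And>Z. \<omega> Z Z = 0"
    and m: "dim (UNIV :: 'a set) = 2 * m" and v: "wedge_power \<omega> m v \<noteq> 0"
    using assms(3) unfolding symplectic_form_def by blast
  have ker': "\<omega> Y X = 0" for Y
    using bilinear_alternating_swap[OF bil alt, of Y X] ker by simp
  have "independent {X}" using \<open>X \<noteq> 0\<close> by simp
  then obtain f :: "'a \<Rightarrow> real" where f: "linear f" "f X = 1"
    using linear_independent_extend[of "{X}" "\<lambda>_. 1"] by auto
  \<comment> \<open>Projection along \<open>X\<close> onto the hyperplane
    \<open>f = 0\<close>.\<close>
  define w where "w i = v i - f (v i) *\<^sub>R X" for i
  have "\<omega> (v i) (v j) = \<omega> (w i) (w j)" for i j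
    by (simp add: w_def bilinear_lsub[OF bil] bilinear_rsub[OF bil] bilinear_lmul[OF bil]
        bilinear_rmul[OF bil] ker ker')
  then have w: "wedge_power \<omega> m w \<noteq> 0" using v wedge_power_cong by metis
  have "inj_on w {..<2 * m}"
    using w wedge_power_eq_entries[of _ m _ w \<omega>] by (auto simp: inj_on_def)
  then have card: "card (w ` {..<2 * m}) = 2 * m"
    and minus: "k < 2 * m \<Longrightarrow> w ` {..<2 * m} - {w k} = w ` ({..<2 * m} - {k})" for k
    by (auto simp: card_image inj_on_def)
  have "independent (w ` {..<2 * m})"
    using wedge_power_dependent[OF bil, of _ m w] w minus by (auto simp: dependent_def)
  \<comment> \<open>The \<open>w i\<close> would form a basis inside the kernel of \<open>f\<close>,
    against \<open>f X = 1\<close>.\<close>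
  then have "span (w ` {..<2 * m}) = UNIV"
    using independent_card_eq_dim_span[OF assms(1,2)] card m by simp
  moreover have "f x = 0" if "x \<in> w ` {..<2 * m}" for x
    using that f by (auto simp: w_def linear_diff linear_scale)
  ultimately have "f X = 0" using linear_eq_0_on_span[OF f(1)] by blast
  then show False using f(2) by simp
qed

section \<open>The recursion operator\<close>

text \<open>Nondegeneracy makes \<open>\<omega>\<close> injective as a map into the dual; in finite
  dimension it is then onto.\<close>

lemma nondegenerate_represents:
  fixes \<omega> :: "'a::real_vector \<Rightarrow> 'a \<Rightarrow> real"
  assumes "finite B" "span B = (UNIV :: 'a set)" and bil: "bilinear \<omega>"
    and nd: "\<And>X. (\<And>Y. \<omega> X Y = 0) \<Longrightarrow> X = 0" and \<phi>: "linear \<phi>"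
  shows "\<exists>X. \<omega> X = \<phi>"
proof -
  obtain C where C: "C \<subseteq> B" "independent C" "span C = (UNIV :: 'a set)"
    using maximal_independent_subset[of B] assms(2) by (metis span_mono span_span top.extremum_uniqueI)
  have fin: "finite C" using C(1) assms(1) finite_subset by blast
  interpret fd: finite_dimensional_vector_space "scaleR :: real \<Rightarrow> 'a \<Rightarrow> 'a" C
    using fin C by unfold_locales (auto simp: dependent_raw_def span_raw_def)
  have eqC: "\<psi> = \<theta>" if "linear \<psi>" "linear \<theta>" "\<And>b. b \<in> C \<Longrightarrow> \<psi> b = \<theta> b" for \<psi> \<theta> :: "'a \<Rightarrow> real"
    using linear_eq_on_span[OF that(1,2), of C] that(3) C(3) by (auto simp: fun_eq_iff)
  have lin: "linear (\<omega> X)" "linear (\<lambda>X. \<omega> X Y)" for X Y using bil by (auto simp: bilinear_def)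
  \<comment> \<open>Identifying a covector with its values on the basis \<open>C\<close> turns
    \<open>\<omega>\<close> into an endomorphism, for which injective implies surjective.\<close>
  define T where "T X = (\<Sum>b\<in>C. \<omega> X b *\<^sub>R b)" for X
  have coeffs: "a b = c b" if "(\<Sum>b\<in>C. a b *\<^sub>R b) = (\<Sum>b\<in>C. c b *\<^sub>R b)" "b \<in> C" for a c b
  proof -
    have "(\<Sum>b\<in>C. (a b - c b) *\<^sub>R b) = 0"
      using that(1) by (simp add: scaleR_diff_left sum_subtractf)
    then show ?thesis using independentD[OF C(2) fin order_refl _ that(2)] by fastforce
  qed
  have T: "linear T"
    unfolding T_def by (intro linear_compose_sum ballI)
      (auto simp: linear_iff bilinear_ladd[OF bil] bilinear_lmul[OF bil] scaleR_add_left)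
  moreover have "inj T"
  proof (subst linear_injective_0[OF T], intro allI impI)
    fix X assume "T X = 0"
    then have "\<omega> X b = 0" if "b \<in> C" for b
      using coeffs[of "\<omega> X" "\<lambda>_. 0" b] that by (simp add: T_def)
    then have "\<omega> X = (\<lambda>_. 0)" using lin by (intro eqC) (auto simp: linear_iff)
    then show "X = 0" using nd by metis
  qed
  ultimately have "surj T"
    by (intro fd.linear_inj_imp_surj) (auto simp: linear_def)
  then obtain X where "T X = (\<Sum>b\<in>C. \<phi> b *\<^sub>R b)" by (metis surjD)
  then have "\<omega> X b = \<phi> b" if "b \<in> C" for b
    using coeffs[of "\<omega> X" \<phi> b] that by (simp add: T_def)
  then have "\<omega> X = \<phi>" using lin \<phi> by (intro eqC) auto
  then show ?thesis ..
qed

text \<open>Nondegeneracy puts the covector \<open>\<eta> X\<close> in the range of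
  \<open>\<omega>\<close>, where the choice made by \<open>inv\<close> is a true preimage.\<close>

lemma recursion_operator_apply:
  assumes "lie_algebra br" "symplectic_form br \<omega>" "bilinear \<eta>"
  shows "\<omega> (recursion_operator \<omega> \<eta> X) Y = \<eta> X Y"
proof -
  obtain B :: "'a set" where B: "finite B" "span B = UNIV"
    using assms(1) unfolding lie_algebra_def by blast
  have "\<exists>Z. \<omega> Z = \<eta> X"
    using assms(2,3) symplectic_nondegenerate[OF B assms(2)]
    by (intro nondegenerate_represents[OF B]) (auto simp: symplectic_form_def bilinear_def)
  then have "\<eta> X \<in> range \<omega>" by (metis rangeI)
  then show ?thesis by (simp add: recursion_operator_def f_inv_into_f)
qed

section \<open>Closed forms and integrability\<close>

lemma closed_form_cyclic:
  assumes "closed_form br \<omega>" and "bilinear br" "\<And>X. br X X = 0" and "bilinear \<omega>"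
  shows "\<omega> (br X Y) Z + \<omega> (br Y Z) X + \<omega> (br Z X) Y = 0"
proof -
  have "br X Z = - br Z X" using bilinear_alternating_swap[OF assms(2,3)] .
  moreover have "ce_diff br 2 (two_form \<omega>) (\<lambda>i. if i = 0 then X else if i = 1 then Y else Z) = 0"
    using assms(1) unfolding closed_form_def by blast
  ultimately show ?thesis
    unfolding ce_diff_two_form by (simp add: bilinear_lneg[OF assms(4)])
qed

lemma nijenhuis_eq_0:
  assumes br: "bilinear br" "\<And>X. br X X = 0" and \<omega>: "bilinear \<omega>" and A: "linear A"
    and nd: "\<And>X. (\<And>Y. \<omega> X Y = 0) \<Longrightarrow> X = 0"
    and adj: "\<And>X Y. \<omega> (A X) Y = \<omega> X (A Y)"
    and closed: "closed_form br \<omega>" "closed_form br (\<lambda>X Y. \<omega> (A X) Y)"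
      "closed_form br (\<lambda>X Y. \<omega> (A (A X)) Y)"
  shows "nijenhuis br A X Y = 0"
proof (rule nd)
  fix Z
  have bil: "bilinear (\<lambda>X Y. \<omega> (A X) Y)" "bilinear (\<lambda>X Y. \<omega> (A (A X)) Y)"
    using \<omega> A linear_compose[of A A] linear_compose[of A "\<lambda>X. \<omega> X Y" for Y]
      linear_compose[of "A \<circ> A" "\<lambda>X. \<omega> X Y" for Y]
    by (auto simp: bilinear_def comp_def)
  note cyc = closed_form_cyclic[OF closed(1) br \<omega>] closed_form_cyclic[OF closed(2) br bil(1)]
    closed_form_cyclic[OF closed(3) br bil(2)]
  \<comment> \<open>Writing \<open>c1\<close>, \<open>c2\<close>, \<open>c3\<close> for the cyclic
    sums of the three forms, the left side is
    \<open>- c1 (A X) (A Y) Z + c2 (A X) Y Z + c2 X (A Y) Z - c3 X Y Z\<close>; the remaining terms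
    cancel in pairs once \<open>adj\<close> has moved every \<open>A\<close> to the left.\<close>
  show "\<omega> (nijenhuis br A X Y) Z = 0"
    using cyc(1)[of "A X" "A Y" Z] cyc(2)[of "A X" Y Z] cyc(2)[of X "A Y" Z] cyc(3)[of X Y Z]
    by (simp add: nijenhuis_def bilinear_ladd[OF \<omega>] bilinear_lsub[OF \<omega>] bilinear_lneg[OF \<omega>]
        flip: adj)
qed

theorem theorem4p6:
  fixes br :: "'a::real_vector \<Rightarrow> 'a \<Rightarrow> 'a"
    and J E :: "'a \<Rightarrow> 'a"
    and \<omega>pK \<omega>cs g :: "'a \<Rightarrow> 'a \<Rightarrow> real"
  assumes "lie_algebra br"
    and "complex_structure br J"
    and "symplectic_form br \<omega>pK" and "skew_symmetric_wrt J \<omega>pK"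
    and "symplectic_form br \<omega>cs" and "symmetric_wrt J \<omega>cs"
    and "E = recursion_operator \<omega>pK \<omega>cs"
    and "g = pseudo_kaehler_metric J \<omega>pK"
  shows "hypersymplectic_structure br J E g \<longleftrightarrow> almost_product_structure E"
proof
  assume "hypersymplectic_structure br J E g"
  then show "almost_product_structure E"
    by (simp add: hypersymplectic_structure_def complex_product_structure_def product_structure_def)
next
  assume E: "almost_product_structure E"
  obtain B :: "'a set" where B: "finite B" "span B = UNIV"
    using assms(1) unfolding lie_algebra_def by blast
  have br: "bilinear br" "\<And>X. br X X = 0" using assms(1) by (auto simp: lie_algebra_def)
  have linE: "linear E" and EE: "E (E X) = X" for X
    using E by (auto simp: almost_product_structure_def fun_eq_iff)
  have linJ: "linear J" and JJ: "J (J X) = - X" for X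
    using assms(2) by (auto simp: complex_structure_def integrable_endo_def fun_eq_iff)
  have bil: "bilinear \<omega>pK" "bilinear \<omega>cs" and cl: "closed_form br \<omega>pK" "closed_form br \<omega>cs"
    and alt: "\<omega>pK X X = 0" "\<omega>cs X X = 0" for X
    using assms(3,5) by (auto simp: symplectic_form_def)
  note sw = bilinear_alternating_swap[OF bil(1) alt(1)] bilinear_alternating_swap[OF bil(2) alt(2)]
  have nd: "X = 0" if "\<And>Y. \<omega>pK X Y = 0" for X
    using symplectic_nondegenerate[OF B assms(3)] that .
  have op: "\<omega>pK (E X) Y = \<omega>cs X Y" for X Y
    using recursion_operator_apply[OF assms(1,3) bil(2)] assms(7) by simp
  have skew: "\<omega>pK (J X) Y = - \<omega>pK X (J Y)" for X Y
    using assms(4) by (simp add: skew_symmetric_wrt_def)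
  have sym: "\<omega>cs (J X) Y = \<omega>cs X (J Y)" for X Y
    using assms(6) by (simp add: symmetric_wrt_def)
  have adj: "\<omega>pK (E X) Y = \<omega>pK X (E Y)" for X Y
    using op sw by metis
  have JE: "J (E X) = - E (J X)" for X
  proof -
    \<comment> \<open>Moving \<open>J\<close> to the right costs a sign in \<open>\<omega>pK\<close>
      but none in \<open>\<omega>cs\<close>, so both summands become
      \<open>\<omega>cs X (J Y)\<close> with opposite signs.\<close>
    have "\<omega>pK (J (E X) + E (J X)) Y = 0" for Y
      by (simp add: bilinear_ladd[OF bil(1)] skew op sym)
    then have "J (E X) + E (J X) = 0" by (rule nd)
    then show ?thesis by (simp add: eq_neg_iff_add_eq_0)
  qed
  \<comment> \<open>These two forms are \<open>\<omega>cs\<close> and, as \<open>E\<close> is an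
    involution, \<open>\<omega>pK\<close> again.\<close>
  have "closed_form br (\<lambda>X Y. \<omega>pK (E X) Y)" "closed_form br (\<lambda>X Y. \<omega>pK (E (E X)) Y)"
    using cl by (simp_all add: op[abs_def] EE)
  then have "nijenhuis br E X Y = 0" for X Y
    by (intro nijenhuis_eq_0[OF br bil(1) linE nd adj cl(1)])
  then have cps: "complex_product_structure br J E"
    using assms(2) E linE JE
    by (auto simp: complex_product_structure_def product_structure_def integrable_endo_def)
  have g: "g X Y = \<omega>pK X (J Y)" for X Y by (simp add: assms(8) pseudo_kaehler_metric_def)
  have "linear (g X)" "linear (\<lambda>X. g X Y)" for X Y
    using bil(1) linear_compose[OF linJ, of "\<omega>pK X"] by (auto simp: g[abs_def] bilinear_def comp_def)
  then have "bilinear g" by (simp add: bilinear_def)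
  moreover have "g X Y = g Y X" for X Y
    using skew sw(1) by (metis g)
  moreover have "X = 0" if "\<And>Y. g X Y = 0" for X
  proof (rule nd)
    show "\<omega>pK X Y = 0" for Y using that[of "J Y"] by (simp add: g JJ bilinear_rneg[OF bil(1)])
  qed
  ultimately have "scalar_product g" unfolding scalar_product_def by blast
  moreover have gJ: "g (J X) Y = \<omega>pK X Y" for X Y
    by (simp add: g skew JJ bilinear_rneg[OF bil(1)])
  then have "g (J X) (J Y) = g X Y" for X Y by (simp add: g)
  \<comment> \<open>The minus sign comes from anticommuting \<open>J\<close> past \<open>E\<close>;
    self-adjointness then merges the two copies of \<open>E\<close> into the identity.\<close>
  moreover have "g (E X) (E Y) = - g X Y" for X Y
    by (simp add: g JE bilinear_rneg[OF bil(1)] EE flip: adj)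
  ultimately have "compatible_metric J E g" unfolding compatible_metric_def by blast
  moreover have "closed_form br (\<lambda>X Y. g (J X) Y)" using cl(1) by (simp add: gJ)
  ultimately show "hypersymplectic_structure br J E g"
    using cps by (simp add: hypersymplectic_structure_def)
qed

end
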